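(* Let $g(1),g(2),\dots,g(K)$ be a decreasing $(1/x)$-convex sequence of numbers in $(0,1]$, let $P(\cdot\,|\,\boldsymbol{x})$ be a probability distribution on a set $\mathcal{Y}$ of $K$ classes, and let $u$ be the set-based utility function determined by $g$. For each $s\in\{1,\dots,K\}$ let $\hat Y_u^{*s}$ be a subset of $\mathcal{Y}$ of cardinality $s$ that maximizes $P(\hat Y\,|\,\boldsymbol{x})$ among all subsets of cardinality $s$. Then for any $s\in\{1,\dots,K-2\}$ the following implication holds: $$U(\hat Y_u^{*s},P,u)>U(\hat Y_u^{*s+1},P,u)\ \Longrightarrow\ U(\hat Y_u^{*s+1},P,u)>U(\hat Y_u^{*s+2},P,u).$$
   Context: $\mathcal{Y}=\{c_1,\dots,c_K\}$ is a finite set of $K$ classes. For a fixed instance $\boldsymbol{x}$, $P(\cdot\,|\,\boldsymbol{x})$ is a probability distribution on $\mathcal{Y}$: $0\le P(c\,|\,\boldsymbol{x})\le 1$ for all $c \in \mathcal{Y}$ and $\sum_{c\in\mathcal{Y}}P(c\,|\,\boldsymbol{x})=1$. For $\hat Y\subseteq\mathcal{Y}$ write $P(\hat Y\,|\,\boldsymbol{x})=\sum_{c\in\hat Y}P(c\,|\,\boldsymbol{x})$. Given a sequence $g(1),\dots,g(K)$ in $[0,1]$, the associated set-based utility function $u:\mathcal{Y}\times(2^{\mathcal{Y}}\setminus\{\emptyset\})\to[0,1]$ is $$u(c,\hat Y)=\begin{cases}0 & \text{if } c\notin\hat Y,\\ g(|\hat Y|) & \text{if } c\in\hat Y.\end{cases}$$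 The expected utility of a non-empty set $\hat Y$ is $U(\hat Y,P,u)=\sum_{c\in\mathcal{Y}}u(c,\hat Y)\,P(c\,|\,\boldsymbol{x})$. Decreasing is meant in the non-strict sense: $g(s+1)\le g(s)$. The sequence $g(1),\dots,g(K)$ is called $(1/x)$-convex if $$\frac{1}{g(s+1)}\le\frac{1}{2}\left(\frac{1}{g(s)}+\frac{1}{g(s+2)}\right)\quad\text{for all } s\in\{1,\dots,K-2\}.$$ *)

theory Defs
  imports Complex_Main
begin

(* P c stands for the conditional probability of the class c given one fixed instance,
   which is left implicit. Values of P outside the class set Y are irrelevant. *)
definition prob_dist_on :: "'a set \<Rightarrow> ('a \<Rightarrow> real) \<Rightarrow> bool" where
  "prob_dist_on Y P \<longleftrightarrow> (\<forall>c\<in>Y. 0 \<le> P c \<and> P c \<le> 1) \<and> (\<Sum>c\<in>Y. P c) = 1"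

definition set_prob :: "('a \<Rightarrow> real) \<Rightarrow> 'a set \<Rightarrow> real" where
  "set_prob P A = (\<Sum>c\<in>A. P c)"

definition set_utility :: "(nat \<Rightarrow> real) \<Rightarrow> 'a \<Rightarrow> 'a set \<Rightarrow> real" where
  "set_utility g c A = (if c \<in> A then g (card A) else 0)"

definition expected_utility ::
  "'a set \<Rightarrow> 'a set \<Rightarrow> ('a \<Rightarrow> real) \<Rightarrow> ('a \<Rightarrow> 'a set \<Rightarrow> real) \<Rightarrow> real" where
  "expected_utility Y A P u = (\<Sum>c\<in>Y. u c A * P c)"

(* Only the terms g 1, ..., g K of a sequence are meaningful. *)
definition decreasing_upto :: "nat \<Rightarrow> (nat \<Rightarrow> real) \<Rightarrow> bool" where
  "decreasing_upto K g \<longleftrightarrow> (\<forall>s\<in>{1..<K}. g (s + 1) \<le> g s)"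

(* For K < 2 the truncated subtraction gives the empty range, as intended. *)
definition recip_convex_upto :: "nat \<Rightarrow> (nat \<Rightarrow> real) \<Rightarrow> bool" where
  "recip_convex_upto K g \<longleftrightarrow>
     (\<forall>s\<in>{1..K - 2}. 1 / g (s + 1) \<le> 1 / 2 * (1 / g s + 1 / g (s + 2)))"

(* Ties are allowed: A is any maximizer among the subsets of Y of cardinality s. *)
definition optimal_subset :: "'a set \<Rightarrow> ('a \<Rightarrow> real) \<Rightarrow> nat \<Rightarrow> 'a set \<Rightarrow> bool" where
  "optimal_subset Y P s A \<longleftrightarrow> is_arg_max (set_prob P) (\<lambda>B. B \<subseteq> Y \<and> card B = s) A"

end

(* Put F s = P(Yopt s), so that U(Yopt s) = g s * F s. Moving one element from an optimal
   (s+2)-set to an optimal s-set gives two (s+1)-sets, hence F is concave. With a = 1/g convex,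
     F (s+1) * a (s+2) - F (s+2) * a (s+1)
       >= F (s+1) * (2 * a (s+1) - a s) - (2 * F (s+1) - F s) * a (s+1)
       = F s * a (s+1) - F (s+1) * a s,
   and the signs of the two ends are those of the two utility differences. *)
theory Submission
  imports Defs
begin

lemma expected_utility_set_utility:
  assumes "finite Y" "A \<subseteq> Y"
  shows "expected_utility Y A P (set_utility g) = g (card A) * set_prob P A"
proof -
  have "expected_utility Y A P (set_utility g) = (\<Sum>c\<in>Y. if c \<in> A then g (card A) * P c else 0)"
    unfolding expected_utility_def set_utility_def by (intro sum.cong) auto
  also have "\<dots> = (\<Sum>c\<in>A. g (card A) * P c)"
    using assms by (simp add: sum.inter_restrict[symmetric] Int_absorb1)
  finally show ?thesis
    by (simp add: set_prob_def sum_distrib_left)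
qed

lemma optimal_subsetD:
  assumes "optimal_subset Y P s A"
  shows "A \<subseteq> Y" "card A = s"
  using assms by (auto simp: optimal_subset_def is_arg_max_def)

lemma optimal_subset_max:
  assumes "optimal_subset Y P s A" "B \<subseteq> Y" "card B = s"
  shows "set_prob P B \<le> set_prob P A"
  using assms by (auto simp: optimal_subset_def is_arg_max_def not_less)

text \<open>Exchange argument: for \<open>x\<close> in \<open>A2\<close> but not in
  \<open>A0\<close>, the sets \<open>insert x A0\<close> and \<open>A2 - {x}\<close> both have
  \<open>s + 1\<close> elements. Their probabilities add up to those of \<open>A0\<close> and
  \<open>A2\<close>, and neither exceeds that of \<open>A1\<close>.\<close>

lemma optimal_subset_concave:
  assumes "finite Y"
    and A0: "optimal_subset Y P s A0"
    and A1: "optimal_subset Y P (s + 1) A1"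
    and A2: "optimal_subset Y P (s + 2) A2"
  shows "set_prob P A0 + set_prob P A2 \<le> 2 * set_prob P A1"
proof -
  note sub = optimal_subsetD[OF A0] optimal_subsetD[OF A2]
  have fin: "finite A0" "finite A2"
    using sub \<open>finite Y\<close> by (auto intro: finite_subset)
  \<comment> \<open>Ties may leave \<open>A0\<close> outside \<open>A2\<close>, so the element to
    move is found by counting: \<open>A2\<close> is larger than \<open>A0\<close>.\<close>
  have "\<not> A2 \<subseteq> A0"
    using card_mono[OF fin(1), of A2] sub by auto
  then obtain x where x: "x \<in> A2" "x \<notin> A0"
    by blast
  have "set_prob P (insert x A0) \<le> set_prob P A1"
    using x sub fin by (intro optimal_subset_max[OF A1]) auto
  moreover have "set_prob P (A2 - {x}) \<le> set_prob P A1"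
    using x sub fin by (intro optimal_subset_max[OF A1]) auto
  moreover have "set_prob P (insert x A0) = P x + set_prob P A0"
    using x fin by (simp add: set_prob_def)
  moreover have "set_prob P A2 = P x + set_prob P (A2 - {x})"
    using x fin by (simp add: set_prob_def sum.remove)
  ultimately show ?thesis
    by linarith
qed

text \<open>Cross-multiplying by the positive denominators makes both comparisons polynomial.
  Convexity is then scaled by \<open>F1\<close> and concavity by \<open>a1\<close>, so that the term
  \<open>2 * F1 * a1\<close> appears in both.\<close>

lemma quotient_decrease_step:
  fixes a0 a1 a2 F0 F1 F2 :: real
  assumes "0 < a0" "0 < a1" "0 < a2" "0 \<le> F1"
    and conv: "2 * a1 \<le> a0 + a2"
    and conc: "F0 + F2 \<le> 2 * F1"
    and less: "F1 / a1 < F0 / a0"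
  shows "F2 / a2 < F1 / a1"
proof -
  have "F1 * a0 < F0 * a1"
    using less assms by (simp add: field_simps)
  moreover have "F1 * (2 * a1) \<le> F1 * (a0 + a2)"
    using conv \<open>0 \<le> F1\<close> by (rule mult_left_mono)
  moreover have "(F0 + F2) * a1 \<le> (2 * F1) * a1"
    using conc \<open>0 < a1\<close> by (intro mult_right_mono) auto
  \<comment> \<open>Adding the three inequalities cancels \<open>2 * F1 * a1\<close>,
    \<open>F1 * a0\<close> and \<open>F0 * a1\<close>; the first one makes the result
    strict.\<close>
  ultimately have "F2 * a1 < F1 * a2"
    by (simp add: algebra_simps)
  then show ?thesis
    using assms by (simp add: field_simps)
qed

theorem theorem2:
  fixes Y :: "'a set" and K :: nat and P :: "'a \<Rightarrow> real"
    and g :: "nat \<Rightarrow> real" and u :: "'a \<Rightarrow> 'a set \<Rightarrow> real" and Yopt :: "nat \<Rightarrow> 'a set"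
  assumes "finite Y" and "card Y = K"
    and "prob_dist_on Y P"
    and "\<forall>s\<in>{1..K}. 0 < g s \<and> g s \<le> 1"
    and "decreasing_upto K g"
    and "recip_convex_upto K g"
    and "u = set_utility g"
    and "\<forall>s\<in>{1..K}. optimal_subset Y P s (Yopt s)"
  shows "\<forall>s\<in>{1..K - 2}.
           expected_utility Y (Yopt s) P u > expected_utility Y (Yopt (s + 1)) P u \<longrightarrow>
           expected_utility Y (Yopt (s + 1)) P u > expected_utility Y (Yopt (s + 2)) P u"
proof (intro ballI impI)
  fix s
  assume s: "s \<in> {1..K - 2}"
    and less: "expected_utility Y (Yopt s) P u > expected_utility Y (Yopt (s + 1)) P u"
  \<comment> \<open>A nonempty range forces \<open>K \<ge> 3\<close>, so the subtraction
    \<open>K - 2\<close> is not truncated here.\<close>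
  have in_range: "s \<in> {1..K}" "s + 1 \<in> {1..K}" "s + 2 \<in> {1..K}"
    using s by auto
  have opt: "optimal_subset Y P t (Yopt t)" if "t \<in> {1..K}" for t
    using assms(8) that by blast
  \<comment> \<open>Dividing by \<open>1 / g t\<close> instead of multiplying by \<open>g t\<close>
    gives the shape \<open>F / a\<close> with \<open>a\<close> convex, as
    \<open>quotient_decrease_step\<close> expects.\<close>
  have util: "expected_utility Y (Yopt t) P u = set_prob P (Yopt t) / (1 / g t)"
    if "t \<in> {1..K}" for t
    using expected_utility_set_utility[OF \<open>finite Y\<close>, of "Yopt t" P g]
      optimal_subsetD[OF opt[OF that]] \<open>u = set_utility g\<close> by simp
  have pos: "0 < 1 / g t" if "t \<in> {1..K}" for t
    using assms(4) that by simp
  have "0 \<le> set_prob P (Yopt (s + 1))"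
    unfolding set_prob_def
    using \<open>prob_dist_on Y P\<close> optimal_subsetD(1)[OF opt[OF in_range(2)]]
    by (intro sum_nonneg) (auto simp: prob_dist_on_def)
  moreover have "2 * (1 / g (s + 1)) \<le> 1 / g s + 1 / g (s + 2)"
    using \<open>recip_convex_upto K g\<close> s unfolding recip_convex_upto_def by force
  moreover have "set_prob P (Yopt s) + set_prob P (Yopt (s + 2)) \<le> 2 * set_prob P (Yopt (s + 1))"
    using optimal_subset_concave[OF \<open>finite Y\<close> opt opt opt] in_range by blast
  ultimately show "expected_utility Y (Yopt (s + 1)) P u > expected_utility Y (Yopt (s + 2)) P u"
    using less quotient_decrease_step[OF pos pos pos] in_range by (simp only: util)
qed

end
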